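(* The assertion "for an arbitrary subset $A$ of $\mathbb{R}$, if $\mathbb{R}\setminus A$ is countable and scattered in $H(A)$, then $H(A)$ is $\sigma$-compact" is false: there exists a subset $A \subseteq \mathbb{R}$ such that $\mathbb{R} \setminus A$ is countable and scattered as a subspace of $H(A)$, but $H(A)$ is not $\sigma$-compact.
   Context: For $A \subseteq \mathbb{R}$, the Hattori space $H(A)$ is the set $\mathbb{R}$ with the topology $\tau(A)$ in which a point $x \in A$ has open neighbourhood basis $\{(x-\epsilon, x+\epsilon) : \epsilon > 0\}$ and a point $x \in \mathbb{R}\setminus A$ has open neighbourhood basis $\{[x, x+\epsilon) : \epsilon > 0\}$. A space is $\sigma$-compact if it is a union of countably many compact subsets. A space is scattered if each of its nonempty subspaces has an isolated point. *)

theory Defs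
  imports "HOL-Analysis.Analysis"
begin

definition hattori_space :: "real set \<Rightarrow> real topology" where
  "hattori_space A = topology (\<lambda>U. \<forall>x\<in>U. \<exists>e>0.
     (if x \<in> A then {x - e<..<x + e} else {x..<x + e}) \<subseteq> U)"

definition sigma_compact_space :: "'a topology \<Rightarrow> bool" where
  "sigma_compact_space X \<longleftrightarrow>
     (\<exists>\<K>. countable \<K> \<and> (\<forall>K\<in>\<K>. compactin X K) \<and> \<Union>\<K> = topspace X)"

definition scattered_space :: "'a topology \<Rightarrow> bool" where
  "scattered_space X \<longleftrightarrow>
     (\<forall>S. S \<subseteq> topspace X \<and> S \<noteq> {} \<longrightarrow> (\<exists>x\<in>S. openin (subtopology X S) {x}))"

lemma openin_hattori_space:
  "openin (hattori_space A) U \<longleftrightarrow>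
     (\<forall>x\<in>U. \<exists>e>0. (if x \<in> A then {x - e<..<x + e} else {x..<x + e}) \<subseteq> U)"
proof -
  let ?N = "\<lambda>x e. if x \<in> A then {x - e<..<x + e} else {x..<x + e}"
  let ?L = "\<lambda>U. \<forall>x\<in>U. \<exists>e>0. ?N x e \<subseteq> U"
  have "istopology ?L"
    unfolding istopology_def
  proof (intro conjI allI impI ballI)
    fix S T x
    assume ST: "?L S" "?L T" and x: "x \<in> S \<inter> T"
    from ST x obtain d e where de: "d > 0" "e > 0" "?N x d \<subseteq> S" "?N x e \<subseteq> T"
      by (meson IntE)
    have "?N x (min d e) \<subseteq> ?N x d" "?N x (min d e) \<subseteq> ?N x e"
      by auto
    with de have "?N x (min d e) \<subseteq> S \<inter> T"
      by blast
    with de show "\<exists>e>0. ?N x e \<subseteq> S \<inter> T"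
      by (metis min_less_iff_conj)
  next
    fix \<K> x
    assume K: "\<forall>K\<in>\<K>. ?L K" and "x \<in> \<Union>\<K>"
    then obtain K where "K \<in> \<K>" "x \<in> K" by blast
    with K obtain e where "e > 0" "?N x e \<subseteq> K" by blast
    with \<open>K \<in> \<K>\<close> show "\<exists>e>0. ?N x e \<subseteq> \<Union>\<K>"
      by (meson Union_upper order_trans)
  qed
  then show ?thesis
    by (simp add: hattori_space_def)
qed

lemma topspace_hattori_space [simp]: "topspace (hattori_space A) = UNIV"
proof -
  have "openin (hattori_space A) UNIV"
    unfolding openin_hattori_space by (auto intro: exI[of _ 1])
  then show ?thesis
    using openin_subset by blast
qed

lemma openin_hattori_space_basic:
  "openin (hattori_space A) {a<..<b}"
  "x \<notin> A \<Longrightarrow> openin (hattori_space A) {x..<b}"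
proof -
  have *: "\<exists>e>0. (if y \<in> A then {y - e<..<y + e} else {y..<y + e}) \<subseteq> {a<..<b}"
    if "a < y" "y < b" for a y
    using that by (intro exI[of _ "min (y - a) (b - y)"]) auto
  then show "openin (hattori_space A) {a<..<b}"
    unfolding openin_hattori_space by auto
  show "openin (hattori_space A) {x..<b}" if "x \<notin> A"
    unfolding openin_hattori_space
  proof
    fix y assume y: "y \<in> {x..<b}"
    show "\<exists>e>0. (if y \<in> A then {y - e<..<y + e} else {y..<y + e}) \<subseteq> {x..<b}"
    proof (cases "y = x")
      case True
      with that y show ?thesis by (intro exI[of _ "b - x"]) auto
    next
      case False
      with y have "x < y" "y < b" by auto
      from *[OF this] show ?thesis
        by (meson dual_order.trans greaterThanLessThan_subseteq_atLeastLessThan_iff order_refl)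
    qed
  qed
qed

end

theory Submission
  imports Defs
begin

text \<open>
  Take a nonempty countable set \<open>B\<close> in which every point is isolated from the right but is a limit
  from the left, and let \<open>A = - B\<close>. In \<open>H(A)\<close> the subspace \<open>B\<close> is discrete. A compact subset of
  \<open>H(A)\<close> is Euclidean closed and does not accumulate from the left at any point of \<open>B\<close>, so it
  is nowhere dense in the Euclidean closure of \<open>B\<close>. By Baire's theorem countably many compact sets
  cannot cover that closure.
\<close>

text \<open>The Hattori topology refines the Euclidean one, since basic neighbourhoods of both kinds
  lie in balls, and compactness passes to coarser topologies.\<close>

lemma compact_if_compactin_hattori_space:
  assumes "compactin (hattori_space A) K"
  shows "compact K"
proof -
  have "openin (hattori_space A) U" if "open U" for U
    unfolding openin_hattori_space
  proof
    fix x assume "x \<in> U"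
    with that obtain e where e: "e > 0" "ball x e \<subseteq> U"
      by (meson openE)
    moreover have "{x - e<..<x + e} \<subseteq> ball x e" "{x..<x + e} \<subseteq> ball x e"
      using \<open>e > 0\<close> by (auto simp: dist_real_def)
    ultimately show "\<exists>e>0. (if x \<in> A then {x - e<..<x + e} else {x..<x + e}) \<subseteq> U"
      by (intro exI[of _ e]) auto
  qed
  then have "compactin euclidean K"
    using compactin_contractive[OF assms, of euclidean] by simp
  then show ?thesis
    by simp
qed

text \<open>The sets \<open>?U n\<close> omit ever shorter intervals just left of \<open>b\<close>,
  are open because \<open>b \<notin> A\<close>, and form an increasing cover of the line. Hence a
  single one of them contains \<open>K\<close>.\<close>

lemma compactin_hattori_space_left_gap:
  assumes K: "compactin (hattori_space A) K" and b: "b \<notin> A"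
  obtains d where "d > 0" "{b - d<..<b} \<inter> K = {}"
proof -
  let ?U = "\<lambda>n::nat. {..<b - inverse (Suc n)} \<union> {b..}"
  have "openin (hattori_space A) (?U n)" for n
  proof -
    have "?U n = (\<Union>a. {a<..<b - inverse (Suc n)}) \<union> (\<Union>c. {b..<c})"
      by (auto simp: lt_ex gt_ex)
    then show ?thesis
      using openin_hattori_space_basic b by (auto intro!: openin_Un openin_Union)
  qed
  moreover have "K \<subseteq> \<Union>(range ?U)"
  proof
    fix x
    show "x \<in> \<Union>(range ?U)"
    proof (cases "x < b")
      case True
      then obtain n where "inverse (real (Suc n)) < b - x"
        using reals_Archimedean[of "b - x"] by auto
      then have "x \<in> ?U n" by simp
      then show ?thesis by blast
    qed auto
  qed
  ultimately obtain \<F> where \<F>: "finite \<F>" "\<F> \<subseteq> range ?U" "K \<subseteq> \<Union>\<F>"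
    using K unfolding compactin_def by (metis (no_types, lifting) rangeE)
  then obtain I where I: "finite I" "\<F> = ?U ` I"
    by (meson finite_subset_image)
  \<comment> \<open>Inserting \<open>0\<close> keeps the maximum meaningful when \<open>I\<close> is
    empty.\<close>
  define N where "N = Max (insert 0 I)"
  have "?U n \<subseteq> ?U N" if "n \<in> I" for n
  proof -
    have "n \<le> N"
      unfolding N_def using I that by simp
    then show ?thesis
      by (intro Un_mono) (simp_all add: field_simps)
  qed
  then have "K \<subseteq> ?U N"
    using \<F> I by blast
  then have "{b - inverse (Suc N)<..<b} \<inter> K = {}"
    by auto
  then show ?thesis
    by (intro that[of "inverse (Suc N)"]) auto
qed

lemma not_sigma_compact_hattori_space:
  assumes "B \<noteq> {}"
    and left: "\<And>b e. b \<in> B \<Longrightarrow> e > 0 \<Longrightarrow> {b - e<..<b} \<inter> B \<noteq> {}"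
  shows "\<not> sigma_compact_space (hattori_space (- B))"
proof
  assume "sigma_compact_space (hattori_space (- B))"
  then obtain \<K> where "countable \<K>" and \<K>: "\<And>K. K \<in> \<K> \<Longrightarrow> compactin (hattori_space (- B)) K"
    and UN: "\<Union>\<K> = UNIV"
    unfolding sigma_compact_space_def by auto
  let ?C = "closure B"
  have dense: "openin (top_of_set ?C) (?C - K) \<and> ?C \<subseteq> closure (?C - K)" if K: "K \<in> \<K>" for K
  proof
    have "closed K"
      using compact_if_compactin_hattori_space[OF \<K>[OF K]] by (rule compact_imp_closed)
    then show "openin (top_of_set ?C) (?C - K)"
      by (simp add: Diff_eq openin_open_Int open_Compl)
    have "B \<subseteq> closure (?C - K)"
    proof
      fix b assume b: "b \<in> B"
      then obtain d where d: "d > 0" "{b - d<..<b} \<inter> K = {}"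
        using compactin_hattori_space_left_gap[OF \<K>[OF K], of b] by auto
      show "b \<in> closure (?C - K)"
        unfolding closure_approachable
      proof (intro allI impI)
        fix e :: real assume "e > 0"
        \<comment> \<open>A point of \<open>B\<close> so close to the left of \<open>b\<close> lies
          in the gap of \<open>K\<close>, hence outside \<open>K\<close>.\<close>
        with d left[OF b, of "min d e"] obtain y where y: "y \<in> B" "b - min d e < y" "y < b"
          by auto
        then have "y \<in> {b - d<..<b}" by simp
        with d y have "y \<in> ?C - K" "dist y b < e"
          using closure_subset[of B] by (auto simp: dist_real_def)
        then show "\<exists>y\<in>?C - K. dist y b < e" by blast
      qed
    qed
    then show "?C \<subseteq> closure (?C - K)"
      by (simp add: closure_minimal)
  qed
  have "?C \<subseteq> closure (\<Inter>K\<in>\<K>. ?C - K)"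
    by (rule Baire) (use dense \<open>countable \<K>\<close> in auto)
  \<comment> \<open>The compact sets cover the line, so no point of \<open>?C\<close> avoids all of
    them.\<close>
  moreover have "(\<Inter>K\<in>\<K>. ?C - K) = {}"
    using UN by blast
  ultimately show False
    using \<open>B \<noteq> {}\<close> by simp
qed

text \<open>The right endpoints of the Cantor set translated to \<open>[-1, 0]\<close>, namely those of the pieces
  that are left after finitely many steps; they are the images of \<open>0\<close> under compositions of
  \<open>x \<mapsto> x / 3\<close> and \<open>x \<mapsto> (x - 2) / 3\<close>.\<close>

primrec cantor_right_endpoint :: "bool list \<Rightarrow> real" where
  "cantor_right_endpoint [] = 0"
| "cantor_right_endpoint (c # cs) = (cantor_right_endpoint cs - (if c then 2 else 0)) / 3"

lemma cantor_right_endpoint_bounds: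
  "- 1 \<le> cantor_right_endpoint cs" "cantor_right_endpoint cs \<le> 0"
  by (induction cs) auto

text \<open>The point \<open>0\<close> is the maximum, and each of the two contractions turns a
  right gap of length \<open>e \<le> 1\<close> into one of length \<open>e / 3\<close>.\<close>

lemma cantor_right_endpoint_right_isolated:
  "\<exists>e>0. {cantor_right_endpoint cs<..<cantor_right_endpoint cs + e} \<inter> range cantor_right_endpoint = {}"
proof (induction cs)
  case Nil
  show ?case
    by (intro exI[of _ 1]) (auto dest: order.strict_trans2[OF _ cantor_right_endpoint_bounds(2)])
next
  case (Cons c cs)
  let ?f = cantor_right_endpoint
  from Cons obtain e' where "e' > 0" and gap': "\<And>ds. \<not> (?f cs < ?f ds \<and> ?f ds < ?f cs + e')"
    by force
  \<comment> \<open>The images of \<open>[-1, 0]\<close> under the two maps,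
    \<open>[-1, -2/3]\<close> and \<open>[-1/3, 0]\<close>, are \<open>1/3\<close> apart. With
    \<open>e \<le> 1\<close>, a gap of length \<open>e / 3\<close> starting in the left one stops
    before any point of the right one.\<close>
  define e where "e = min 1 e'"
  have e: "e > 0" "e \<le> 1"
    using \<open>e' > 0\<close> by (auto simp: e_def)
  have gap: "\<not> (?f cs < ?f ds \<and> ?f ds < ?f cs + e)" for ds
    using gap'[of ds] by (auto simp: e_def)
  have "\<not> (?f (c # cs) < ?f ds \<and> ?f ds < ?f (c # cs) + e / 3)" for ds
  proof (cases ds)
    \<comment> \<open>As \<open>0\<close> is fixed by \<open>x / 3\<close>, the empty list gives the
      same point as \<open>[False]\<close>.\<close>
    case Nil
    then show ?thesis
      using e gap[of "[]"] cantor_right_endpoint_bounds[of cs] by (auto split: if_splits simp: field_simps)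
  next
    case ds: (Cons d ds')
    then show ?thesis
      using e gap[of ds'] cantor_right_endpoint_bounds[of cs] cantor_right_endpoint_bounds[of ds']
      by (auto split: if_splits simp: field_simps)
  qed
  with e show ?case
    by (intro exI[of _ "e / 3"]) auto
qed

text \<open>The points \<open>- (2 / 3) * (1 / 3) ^ n\<close> approach \<open>0\<close> from the
  left. Both contractions are increasing with ratio \<open>1/3\<close>, so they carry an
  approximation within \<open>3 * e\<close> to one within \<open>e\<close>.\<close>

lemma cantor_right_endpoint_left_limit:
  assumes "e > 0"
  shows "\<exists>ds. cantor_right_endpoint cs - e < cantor_right_endpoint ds
    \<and> cantor_right_endpoint ds < cantor_right_endpoint cs"
  using assms
proof (induction cs arbitrary: e)
  case Nil
  have pow: "cantor_right_endpoint (replicate n False @ [True]) = - (2 / 3) * (1 / 3) ^ n" for n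
    by (induction n) auto
  obtain n where "(1 / 3 :: real) ^ n < e"
    using real_arch_pow_inv[OF Nil, of "1 / 3"] by auto
  moreover have "(0::real) < (1 / 3) ^ n" by simp
  ultimately show ?case
    by (intro exI[of _ "replicate n False @ [True]"]) (simp only: pow cantor_right_endpoint.simps, linarith)
next
  case (Cons c cs)
  obtain ds where "cantor_right_endpoint cs - 3 * e < cantor_right_endpoint ds"
    "cantor_right_endpoint ds < cantor_right_endpoint cs"
    using Cons.IH[of "3 * e"] Cons.prems by auto
  then show ?case
    by (intro exI[of _ "c # ds"]) (auto simp: field_simps)
qed

text \<open>For \<open>b \<in> B\<close> the half-open interval from \<open>b\<close> is open, and a
  short one meets \<open>B\<close> only in \<open>b\<close>. So any point of \<open>S\<close> serves
  as the isolated point.\<close>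

lemma scattered_space_if_right_isolated:
  assumes "\<And>b. b \<in> B \<Longrightarrow> \<exists>e>0. {b<..<b + e} \<inter> B = {}"
  shows "scattered_space (subtopology (hattori_space (- B)) B)"
  unfolding scattered_space_def
proof (intro allI impI)
  fix S assume S: "S \<subseteq> topspace (subtopology (hattori_space (- B)) B) \<and> S \<noteq> {}"
  then obtain b where b: "b \<in> S" "b \<in> B" and "S \<subseteq> B" by auto
  with assms obtain e where e: "e > 0" "{b<..<b + e} \<inter> B = {}" by blast
  have "{b} = S \<inter> {b..<b + e}"
  proof -
    have "x = b" if "x \<in> S" "x \<in> {b..<b + e}" for x
    proof (rule ccontr)
      assume "x \<noteq> b"
      with that have "x \<in> {b<..<b + e}" by simp
      with that e \<open>S \<subseteq> B\<close> show False by blast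
    qed
    with b e show ?thesis by auto
  qed
  moreover have "openin (hattori_space (- B)) {b..<b + e}"
    using openin_hattori_space_basic(2) b by simp
  ultimately have "openin (subtopology (hattori_space (- B)) S) {b}"
    by (simp add: openin_subtopology_Int2)
  moreover have "subtopology (subtopology (hattori_space (- B)) B) S = subtopology (hattori_space (- B)) S"
    using \<open>S \<subseteq> B\<close> by (simp add: subtopology_subtopology Int_absorb1)
  ultimately show "\<exists>x\<in>S. openin (subtopology (subtopology (hattori_space (- B)) B) S) {x}"
    using b by auto
qed

theorem corollary2p5:
  shows "\<exists>A :: real set.
    countable (UNIV - A) \<and>
    scattered_space (subtopology (hattori_space A) (UNIV - A)) \<and>
    \<not> sigma_compact_space (hattori_space A)"
proof -
  define B where "B = range cantor_right_endpoint"
  have "countable B"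
    unfolding B_def by simp
  moreover have "scattered_space (subtopology (hattori_space (- B)) B)"
    using cantor_right_endpoint_right_isolated
    by (intro scattered_space_if_right_isolated) (auto simp: B_def)
  moreover have "\<not> sigma_compact_space (hattori_space (- B))"
  proof (rule not_sigma_compact_hattori_space)
    show "B \<noteq> {}"
      by (simp add: B_def)
    show "{b - e<..<b} \<inter> B \<noteq> {}" if "b \<in> B" "e > 0" for b e
      using that cantor_right_endpoint_left_limit unfolding B_def by fastforce
  qed
  moreover have "UNIV - - B = B" by auto
  ultimately show ?thesis
    by (intro exI[of _ "- B"]) simp
qed

end
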